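(* Let $b\ge2$ be an integer. For every integer $n\ge0$ and all $X,Y\in\mathbb{C}$, $$(X+Y)^{S_b(n)}=\sum_{k=0}^{n}\binom{n}{k}_b X^{S_b(k)}Y^{S_b(n-k)},$$ where $S_b(m)$ denotes the sum of the base-$b$ digits of $m$ and the $b$-ary binomial coefficients are defined as follows: if $n=\sum_{l=0}^{N_n-1}n_lb^l$ and $k=\sum_{l=0}^{N_k-1}k_lb^l$ are the base-$b$ expansions (with $N_n,N_k$ the numbers of digits, and digits beyond the expansion taken to be $0$), and $N=\max\{N_n,N_k\}$, then $$\binom{n}{k}_b=\prod_{l=0}^{N-1}\binom{n_l}{k_l},$$ with the usual convention $\binom{a}{c}=0$ if $c>a$.
   Context: Base-$b$ digits of $m\ge0$: the unique $m_l\in\{0,\dots,b-1\}$ with $m=\sum_l m_lb^l$. $S_b(m)=\sum_l m_l$. Convention $0^0=1$. *)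

theory Defs
  imports Complex_Main "HOL-Library.Log_Nat"
begin

definition digit :: "nat \<Rightarrow> nat \<Rightarrow> nat \<Rightarrow> nat"
  where "digit b m l = (m div b ^ l) mod b"

(* For b >= 2, the library function floorlog b m is the number of base-b digits of m
   (m < b ^ N iff floorlog b m <= N); in particular 0 has the empty expansion. *)

definition digit_sum :: "nat \<Rightarrow> nat \<Rightarrow> nat"
  where "digit_sum b m = (\<Sum>l<floorlog b m. digit b m l)"

definition bary_binomial :: "nat \<Rightarrow> nat \<Rightarrow> nat \<Rightarrow> nat"
  where "bary_binomial b n k =
    (\<Prod>l<max (floorlog b n) (floorlog b k). digit b n l choose digit b k l)"

(* The following lemmas identify digit b m as the base-b digit sequence of m. *)

lemma digit_less: "b \<ge> 2 \<Longrightarrow> digit b m l < b"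
  by (simp add: digit_def)

lemma sum_digits_mod: "(\<Sum>l<N. digit b m l * b ^ l) = m mod b ^ N"
proof (induction N)
  case (Suc N)
  then show ?case
    using mod_mult2_eq[of m "b ^ N" b] by (simp add: digit_def mult.commute)
qed simp

lemma base_expansion:
  assumes "b \<ge> 2"
  shows "m = (\<Sum>l<floorlog b m. digit b m l * b ^ l)"
  using assms floorlog_leD[of b m "floorlog b m"] by (simp add: sum_digits_mod)

lemma digit_beyond:
  assumes "b \<ge> 2" and "l \<ge> floorlog b m"
  shows "digit b m l = 0"
  using assms floorlog_leD[of b m l] by (simp add: digit_def)

lemma digit_unique:
  assumes "b \<ge> 2" and "\<And>l. l < N \<Longrightarrow> d l < b" and "m = (\<Sum>l<N. d l * b ^ l)" and "l < N"
  shows "d l = digit b m l"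
  using assms(2-)
proof (induction N arbitrary: d m l)
  case (Suc N)
  define m' where "m' = (\<Sum>l<N. d (Suc l) * b ^ l)"
  have m: "m = d 0 + b * m'"
    unfolding Suc.prems(2) m'_def
    by (subst sum.lessThan_Suc_shift) (simp add: sum_distrib_left mult_ac)
  have d0: "d 0 < b"
    using Suc.prems(1) by simp
  show ?case
  proof (cases l)
    case 0
    then show ?thesis
      using m d0 by (simp add: digit_def)
  next
    case (Suc j)
    have "m div b = m'"
      using m d0 assms(1) by simp
    then have "digit b m (Suc j) = digit b m' j"
      by (simp add: digit_def div_mult2_eq)
    moreover have "d (Suc j) = digit b m' j"
      using Suc.IH[of "\<lambda>l. d (Suc l)" m' j] Suc.prems Suc m'_def by simp
    ultimately show ?thesis
      using Suc by simp
  qed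
qed simp

end

(* Splitting off the last digit, n = n0 + b n' and k = r + b q, every ingredient factors: digit sums
   become sums and b-ary binomials become products. Terms with r > n0 vanish, and for r \<le> n0 the
   subtraction n - k = (n0 - r) + b (n' - q) is carry-free, so the right-hand side is the product of
   the ordinary binomial expansion for n0 and the b-ary one for n'. *)
theory Submission
  imports Defs
begin

lemma digit_0: "digit b m 0 = m mod b"
  by (simp add: digit_def)

lemma digit_Suc: "digit b m (Suc l) = digit b (m div b) l"
  by (simp add: digit_def div_mult2_eq)

text \<open>Digits beyond the expansion are 0, so any upper bound \<open>N\<close> on the length may
  serve as the range of summation.\<close>

lemma digit_sum_eq_sum:
  assumes "b \<ge> 2" and "floorlog b m \<le> N"
  shows "digit_sum b m = (\<Sum>l<N. digit b m l)"
  unfolding digit_sum_def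
  by (rule sum.mono_neutral_left) (use assms in \<open>auto simp: digit_beyond\<close>)

text \<open>Padding is harmless here as well: each extra factor is \<open>0 choose 0\<close>, which
  is 1.\<close>

lemma bary_binomial_eq_prod:
  assumes "b \<ge> 2" and "floorlog b n \<le> N" and "floorlog b k \<le> N"
  shows "bary_binomial b n k = (\<Prod>l<N. digit b n l choose digit b k l)"
  unfolding bary_binomial_def
  by (rule prod.mono_neutral_left) (use assms in \<open>auto simp: digit_beyond\<close>)

lemma digit_sum_rec:
  assumes "b \<ge> 2"
  shows "digit_sum b m = m mod b + digit_sum b (m div b)"
proof -
  \<comment> \<open>With this generous bound, \<open>Suc N\<close> positions suffice for
    \<open>m\<close> and \<open>N\<close> for \<open>m div b\<close>. No exact relation between the
    two lengths is needed, so m = 0 is no special case.\<close>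
  define N where "N = max (floorlog b m) (floorlog b (m div b))"
  have "digit_sum b m = (\<Sum>l<Suc N. digit b m l)"
    by (rule digit_sum_eq_sum) (use assms in \<open>auto simp: N_def\<close>)
  also have "\<dots> = m mod b + (\<Sum>l<N. digit b (m div b) l)"
    by (simp add: sum.lessThan_Suc_shift digit_0 digit_Suc del: sum.lessThan_Suc)
  also have "(\<Sum>l<N. digit b (m div b) l) = digit_sum b (m div b)"
    by (rule digit_sum_eq_sum [symmetric]) (use assms in \<open>auto simp: N_def\<close>)
  finally show ?thesis .
qed

lemma bary_binomial_rec:
  assumes "b \<ge> 2"
  shows "bary_binomial b n k = (n mod b choose (k mod b)) * bary_binomial b (n div b) (k div b)"
proof -
  define N where "N = Max {floorlog b n, floorlog b (n div b), floorlog b k, floorlog b (k div b)}"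
  have "bary_binomial b n k = (\<Prod>l<Suc N. digit b n l choose digit b k l)"
    by (rule bary_binomial_eq_prod) (use assms in \<open>auto simp: N_def\<close>)
  also have "\<dots> = (n mod b choose (k mod b)) *
      (\<Prod>l<N. digit b (n div b) l choose digit b (k div b) l)"
    by (simp add: prod.lessThan_Suc_shift digit_0 digit_Suc del: prod.lessThan_Suc)
  also have "(\<Prod>l<N. digit b (n div b) l choose digit b (k div b) l) =
      bary_binomial b (n div b) (k div b)"
    by (rule bary_binomial_eq_prod [symmetric]) (use assms in \<open>auto simp: N_def\<close>)
  finally show ?thesis .
qed

text \<open>Once the indices with too large a last digit are dropped, the pairs (k mod b, k div b)
  fill a whole rectangle: k \<le> n bounds the quotient, and conversely r \<le> n mod b and q \<le>
  n div b give r + b q \<le> n.\<close>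

lemma sum_atMost_split_last_digit:
  fixes f :: "nat \<Rightarrow> 'a::comm_monoid_add"
  assumes "b > 0" and "\<And>k. n mod b < k mod b \<Longrightarrow> f k = 0"
  shows "(\<Sum>k\<le>n. f k) = (\<Sum>r\<le>n mod b. \<Sum>q\<le>n div b. f (r + b * q))"
proof -
  have le: "r + b * q \<le> n" if "r \<le> n mod b" "q \<le> n div b" for r q
    using add_mono[OF that(1) mult_le_mono2[OF that(2), of b]] by simp
  have less: "r < b" if "r \<le> n mod b" for r
    using that assms(1) by (meson le_less_trans mod_less_divisor)
  have "(\<Sum>k\<le>n. f k) = (\<Sum>k\<in>{k. k \<le> n \<and> k mod b \<le> n mod b}. f k)"
    by (rule sum.mono_neutral_right) (auto intro: assms(2))
  also have "\<dots> = (\<Sum>(r, q)\<in>{..n mod b} \<times> {..n div b}. f (r + b * q))"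
    by (rule sum.reindex_bij_witness
        [where i = "\<lambda>(r, q). r + b * q" and j = "\<lambda>k. (k mod b, k div b)"])
      (use assms(1) in \<open>auto simp: less le div_le_mono\<close>)
  finally show ?thesis
    by (simp add: sum.cartesian_product)
qed

theorem theorem3p1:
  fixes b n :: nat and X Y :: complex
  assumes "b \<ge> 2"
  shows "(X + Y) ^ digit_sum b n =
    (\<Sum>k=0..n. of_nat (bary_binomial b n k) * X ^ digit_sum b k * Y ^ digit_sum b (n - k))"
proof (induction n rule: less_induct)
  case (less n)
  let ?t = "\<lambda>n k. of_nat (bary_binomial b n k) * X ^ digit_sum b k * Y ^ digit_sum b (n - k)"
  show ?case
  proof (cases "n = 0")
    case True
    then show ?thesis
      by (simp add: digit_sum_def bary_binomial_def floorlog_def)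
  next
    case False
    define n0 n' where "n0 = n mod b" and "n' = n div b"
    have "n0 < b" and n: "n = n0 + b * n'"
      using assms by (simp_all add: n0_def n'_def)
    have summand: "?t n (r + b * q) = (of_nat (n0 choose r) * X ^ r * Y ^ (n0 - r)) * ?t n' q"
      if "r \<le> n0" "q \<le> n'" for r q
    proof -
      \<comment> \<open>These bounds make r and n0 - r the last digits of r + b q and of its
        complement in n, with quotients q and n' - q, as the recursions require.\<close>
      have "r < b" "n0 - r < b"
        using that \<open>n0 < b\<close> by auto
      moreover have "n - (r + b * q) = (n0 - r) + b * (n' - q)"
        using that by (simp add: n diff_mult_distrib2 mult_le_mono2)
      ultimately have "digit_sum b (r + b * q) = r + digit_sum b q"
        and "digit_sum b (n - (r + b * q)) = (n0 - r) + digit_sum b (n' - q)"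
        and "bary_binomial b n (r + b * q) = (n0 choose r) * bary_binomial b n' q"
        using assms digit_sum_rec[of b "r + b * q"] digit_sum_rec[of b "(n0 - r) + b * (n' - q)"]
          bary_binomial_rec[of b n "r + b * q"]
        by (simp_all add: n0_def n'_def)
      then show ?thesis
        by (simp add: power_add mult_ac)
    qed
    have "(X + Y) ^ digit_sum b n = (X + Y) ^ n0 * (X + Y) ^ digit_sum b n'"
      using assms digit_sum_rec[of b n] by (simp add: power_add n0_def n'_def)
    also have "\<dots> = (\<Sum>r\<le>n0. of_nat (n0 choose r) * X ^ r * Y ^ (n0 - r)) * (\<Sum>q\<le>n'. ?t n' q)"
      \<comment> \<open>The induction hypothesis applies because n > 0 and b \<ge> 2 give n' <
        n.\<close>
      using less.IH[of n'] False assms by (simp add: binomial_ring n'_def atMost_atLeast0)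
    also have "\<dots> = (\<Sum>r\<le>n0. \<Sum>q\<le>n'. ?t n (r + b * q))"
      by (simp add: sum_product summand)
    also have "\<dots> = (\<Sum>k\<le>n. ?t n k)"
      unfolding n0_def n'_def
      \<comment> \<open>If k mod b exceeds n mod b, the last-digit factor of
        \<open>bary_binomial b n k\<close> is 0, so the summand vanishes.\<close>
      by (rule sum_atMost_split_last_digit [symmetric])
        (use assms in \<open>auto simp: bary_binomial_rec[of b n] binomial_eq_0\<close>)
    finally show ?thesis
      by (simp add: atMost_atLeast0)
  qed
qed

end
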